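(* Let $q>2$ and $n\ge1$ be integers with $n\equiv q \pmod{q^2}$, and let $\lambda$ be a positive integer. Then every $\lambda$-fold $1$-packing $C$ in $H(n,q)$ with minimum distance $2$ satisfies $$|C| \le \frac{\lambda q^n}{n(q-1)+q}.$$
   Context: $H(n,q)$ is the Hamming graph on words of length $n$ over $\{0,1,\ldots,q-1\}$, two words adjacent iff they differ in exactly one position. A $\lambda$-fold $1$-packing is a multiset $C$ of vertices such that every vertex of $H(n,q)$ is at Hamming distance at most $1$ from at most $\lambda$ elements of $C$, counted with multiplicity. Minimum distance $2$ means that the Hamming distance between any two distinct elements of $C$ (in particular, no element is repeated) is at least $2$, with $2$ attained. *)

theory Defs
  imports Complex_Main "HOL-Library.Multiset" "HOL-Number_Theory.Cong"
begin

definition hamming_vertices :: "nat \<Rightarrow> nat \<Rightarrow> nat list set" where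
  "hamming_vertices n q = {w. set w \<subseteq> {0..<q} \<and> length w = n}"

text \<open>Only used for words of equal length, where it coincides with the path distance
  of the Hamming graph.\<close>

definition hamming_dist :: "'a list \<Rightarrow> 'a list \<Rightarrow> nat" where
  "hamming_dist x y = card {i. i < length x \<and> x ! i \<noteq> y ! i}"

definition one_packing :: "nat \<Rightarrow> nat \<Rightarrow> nat \<Rightarrow> nat list multiset \<Rightarrow> bool" where
  "one_packing n q l C \<longleftrightarrow>
     set_mset C \<subseteq> hamming_vertices n q \<and>
     (\<forall>v\<in>hamming_vertices n q. size {#c \<in># C. hamming_dist v c \<le> 1#} \<le> l)"

text \<open>The pairs with \<open>{#x, y#} \<subseteq># C\<close> are the pairs of distinct members of \<open>C\<close>, where two
  copies of the same word count as distinct members, at distance \<open>0\<close>. Hence a positive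
  minimum distance forces \<open>C\<close> to have no repeated word.\<close>

definition has_min_distance :: "'a list multiset \<Rightarrow> nat \<Rightarrow> bool" where
  "has_min_distance C d \<longleftrightarrow>
     (\<forall>x y. {#x, y#} \<subseteq># C \<longrightarrow> d \<le> hamming_dist x y) \<and>
     (\<exists>x y. {#x, y#} \<subseteq># C \<and> hamming_dist x y = d)"

end

theory Submission
  imports Defs
begin

text \<open>Let \<open>A\<close> be the adjacency operator of the Hamming graph and \<open>f\<close> the indicator function of
  \<open>C\<close>. Since \<open>q\<close> divides \<open>n\<close>, all eigenvalues \<open>n (q - 1) - q j\<close> of \<open>A\<close> are multiples of \<open>q\<close>, so
  \<open>A (A + q)\<close> is positive semidefinite, and comparing with its component along the constant
  functions gives \<open>k (k + q) |C|\<^sup>2 / q\<^sup>n \<le> \<langle>f, A (A + q) f\<rangle>\<close> with \<open>k = n (q - 1)\<close>. As \<open>C\<close> is an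
  independent set, the right-hand side is the sum of \<open>(A f)\<^sup>2\<close>; the packing condition
  \<open>A f \<le> \<lambda>\<close> bounds it by \<open>\<lambda> k |C|\<close>. The spectral inequality is
  proved by induction on \<open>n\<close>, splitting a function into its average over the first letter and
  a part that sums to zero over the first letter.\<close>

section \<open>Line sums and the spectral inequality\<close>

lemma finite_hamming_vertices [simp]: "finite (hamming_vertices n q)"
  unfolding hamming_vertices_def by (rule finite_lists_length_eq) simp

lemma hamming_vertices_0 [simp]: "hamming_vertices 0 q = {[]}"
  by (auto simp: hamming_vertices_def)

lemma sum_hamming_vertices_Suc:
  fixes F :: "nat list \<Rightarrow> real"
  shows "(\<Sum>v\<in>hamming_vertices (Suc n) q. F v)
    = (\<Sum>w\<in>hamming_vertices n q. \<Sum>a<q. F (a # w))"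
proof -
  have "(\<Sum>w\<in>hamming_vertices n q. \<Sum>a<q. F (a # w))
      = (\<Sum>(w, a)\<in>hamming_vertices n q \<times> {..<q}. F (a # w))"
    by (simp add: sum.cartesian_product)
  also have "\<dots> = (\<Sum>v\<in>hamming_vertices (Suc n) q. F v)"
    by (rule sum.reindex_bij_witness[of _ "\<lambda>v. (tl v, hd v)" "\<lambda>(w, a). a # w"])
      (auto simp: hamming_vertices_def length_Suc_conv)
  finally show ?thesis by simp
qed

text \<open>On words of length \<open>n\<close> this is the operator \<open>A + n\<close>, because each of the \<open>n\<close> lines
  through \<open>v\<close> contributes \<open>f v\<close> once.\<close>

definition line_sum :: "nat \<Rightarrow> nat \<Rightarrow> (nat list \<Rightarrow> real) \<Rightarrow> nat list \<Rightarrow> real" where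
  "line_sum q n f v = (\<Sum>i<n. \<Sum>b<q. f (v[i := b]))"

lemma line_sum_Cons:
  "line_sum q (Suc n) f (a # w) = line_sum q n (\<lambda>u. f (a # u)) w + (\<Sum>b<q. f (b # w))"
  unfolding line_sum_def by (subst sum.lessThan_Suc_shift) simp

lemma line_sum_add: "line_sum q n (\<lambda>u. f u + g u) w = line_sum q n f w + line_sum q n g w"
  by (simp add: line_sum_def sum.distrib)

lemma line_sum_sum: "line_sum q n (\<lambda>u. \<Sum>a\<in>I. f a u) w = (\<Sum>a\<in>I. line_sum q n (f a) w)"
  unfolding line_sum_def
  by (subst sum.swap, rule sum.cong[OF refl]) (subst sum.swap, rule refl)

text \<open>Each value \<open>f v\<close> is counted once for every position and every letter that
  may have stood there before.\<close>

lemma sum_line_sum: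
  "(\<Sum>v\<in>hamming_vertices n q. line_sum q n f v)
    = real n * real q * (\<Sum>v\<in>hamming_vertices n q. f v)"
proof (induction n arbitrary: f)
  case 0
  then show ?case by (simp add: line_sum_def)
next
  case (Suc n)
  have "(\<Sum>v\<in>hamming_vertices (Suc n) q. line_sum q (Suc n) f v)
     = (\<Sum>w\<in>hamming_vertices n q. line_sum q n (\<lambda>u. \<Sum>a<q. f (a # u)) w)
       + real q * (\<Sum>w\<in>hamming_vertices n q. \<Sum>a<q. f (a # w))"
    by (simp add: sum_hamming_vertices_Suc line_sum_Cons line_sum_sum sum.distrib sum_distrib_left)
  then show ?case
    by (simp add: Suc.IH sum_hamming_vertices_Suc algebra_simps)
qed

text \<open>The density of the quadratic form of \<open>(L - q c) (L - q (c - 1))\<close>, where \<open>L\<close> is the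
  line-sum operator.\<close>

definition spectral_form :: "real \<Rightarrow> real \<Rightarrow> real \<Rightarrow> real \<Rightarrow> real" where
  "spectral_form q c x y = y\<^sup>2 - q * (2 * c - 1) * x * y + q\<^sup>2 * (c * (c - 1)) * x\<^sup>2"

text \<open>On the average \<open>g\<close> the line of the first letter adds \<open>q * g\<close>,
  which turns \<open>c\<close> into \<open>c - 1\<close>; on the zero-sum part it adds nothing, so
  \<open>c\<close> stays. The cross terms are linear in \<open>H a\<close> and \<open>h a\<close>,
  with coefficients \<open>s\<close> and \<open>t\<close> free of \<open>a\<close>, and cancel over
  \<open>a\<close>.\<close>

lemma sum_spectral_form_split:
  assumes h: "(\<Sum>a<q. h a) = 0" and H: "(\<Sum>a<q. H a) = 0"
  shows "(\<Sum>a<q. spectral_form (real q) c (g + h a) (G + real q * g + H a))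
    = real q * spectral_form (real q) (c - 1) g G + (\<Sum>a<q. spectral_form (real q) c (h a) (H a))"
proof -
  define s where "s = 2 * (G + real q * g) - real q * (2 * c - 1) * g"
  define t where
    "t = 2 * (real q)\<^sup>2 * (c * (c - 1)) * g - real q * (2 * c - 1) * (G + real q * g)"
  have "spectral_form (real q) c (g + h a) (G + real q * g + H a)
    = spectral_form (real q) (c - 1) g G + spectral_form (real q) c (h a) (H a)
      + s * H a + t * h a" for a
    unfolding spectral_form_def s_def t_def by (simp add: power2_eq_square algebra_simps)
  then show ?thesis
    by (simp add: sum.distrib h H flip: sum_distrib_left)
qed

lemma consecutive_product_nonneg: "0 \<le> real_of_int i * (real_of_int i + 1)"
proof (cases "i \<ge> 0")
  case False
  then have "i \<le> -1" by simp
  then have "real_of_int i \<le> -1" by linarith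
  then show ?thesis by (intro mult_nonpos_nonpos) auto
qed simp

text \<open>\<open>L\<close> has eigenvalues \<open>q * (n - j)\<close>, so the form has eigenvalues
  \<open>q\<^sup>2 * (n - j - c) * (n - j - c + 1)\<close>, nonnegative as \<open>c\<close> is an
  integer; \<open>j = 0\<close> belongs to the constants. The induction shifts \<open>c\<close>,
  hence its generality.\<close>

lemma spectral_inequality:
  fixes c :: int
  assumes "q > 0"
  shows "(real q)\<^sup>2 * ((real n - c) * (real n - c + 1))
      * (\<Sum>v\<in>hamming_vertices n q. f v)\<^sup>2 / real q ^ n
    \<le> (\<Sum>v\<in>hamming_vertices n q. spectral_form (real q) c (f v) (line_sum q n f v))"
proof (induction n arbitrary: f c)
  case 0
  then show ?case by (simp add: line_sum_def spectral_form_def algebra_simps)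
next
  case (Suc n)
  let ?V = "hamming_vertices n q"
  define g where "g w = (\<Sum>a<q. f (a # w)) / real q" for w
  define h where "h a w = f (a # w) - g w" for a w
  have h0: "(\<Sum>a<q. h a w) = 0" for w
    using assms by (simp add: h_def g_def sum_subtractf)
  have H0: "(\<Sum>a<q. line_sum q n (h a) w) = 0" for w
    by (simp add: h0 flip: line_sum_sum) (simp add: line_sum_def)
  have f: "f (a # w) = g w + h a w" for a w by (simp add: h_def)
  have L: "line_sum q (Suc n) f (a # w)
      = line_sum q n g w + real q * g w + line_sum q n (h a) w" for a w
    unfolding line_sum_Cons using assms by (simp add: f line_sum_add sum.distrib h0)
  have "(real q)\<^sup>2 * ((real (Suc n) - c) * (real (Suc n) - c + 1))
        * (\<Sum>v\<in>hamming_vertices (Suc n) q. f v)\<^sup>2 / real q ^ Suc n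
      = real q * ((real q)\<^sup>2 * ((real n - (c - 1)) * (real n - (c - 1) + 1))
        * (\<Sum>w\<in>?V. g w)\<^sup>2 / real q ^ n)"
  proof -
    have "(\<Sum>v\<in>hamming_vertices (Suc n) q. f v) = real q * (\<Sum>w\<in>?V. g w)"
      using assms by (simp add: sum_hamming_vertices_Suc g_def flip: sum_divide_distrib)
    then show ?thesis
      using assms by (simp add: power2_eq_square field_simps)
  qed
  also have "\<dots> \<le> real q * (\<Sum>w\<in>?V. spectral_form (real q) (c - 1) (g w) (line_sum q n g w))"
    using Suc.IH[of "c - 1" g] by (intro mult_left_mono) auto
  \<comment> \<open>The induction hypothesis with the same \<open>c\<close> shows that each zero-sum
    part contributes a nonnegative amount.\<close>
  also have "\<dots> \<le> \<dots> + (\<Sum>a<q. \<Sum>w\<in>?V. spectral_form (real q) c (h a w) (line_sum q n (h a) w))"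
  proof -
    have "0 \<le> (real n - c) * (real n - c + 1)"
      using consecutive_product_nonneg[of "int n - c"] by simp
    then have "0 \<le> (\<Sum>w\<in>?V. spectral_form (real q) c (h a w) (line_sum q n (h a) w))" for a
      by (intro order.trans[OF _ Suc.IH]) simp
    then show ?thesis by (simp add: sum_nonneg)
  qed
  also have "\<dots> = (\<Sum>v\<in>hamming_vertices (Suc n) q.
      spectral_form (real q) c (f v) (line_sum q (Suc n) f v))"
    unfolding sum_hamming_vertices_Suc L f sum_spectral_form_split[OF h0 H0]
    by (subst sum.swap) (simp add: sum.distrib sum_distrib_left)
  finally show ?case .
qed

section \<open>Indicator functions of independent packings\<close>

lemma hamming_dist_list_update:
  assumes "i < length v" "b \<noteq> v ! i"
  shows "hamming_dist v (v[i := b]) = 1"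
proof -
  have "{j. j < length v \<and> v ! j \<noteq> v[i := b] ! j} = {i}"
    using assms by (auto simp: nth_list_update)
  then show ?thesis by (simp add: hamming_dist_def)
qed

text \<open>Each of the \<open>n\<close> lines through \<open>v\<close> meets \<open>S\<close> in
  \<open>v\<close> alone; equivalently, \<open>A f\<close> vanishes on \<open>S\<close>.\<close>

lemma line_sum_indicator_member:
  assumes "S \<subseteq> hamming_vertices n q" "v \<in> S"
    and "\<And>w. w \<in> S \<Longrightarrow> hamming_dist v w \<noteq> 1"
  shows "line_sum q n (\<lambda>w. of_bool (w \<in> S)) v = real n"
proof -
  have v: "length v = n" "\<And>i. i < n \<Longrightarrow> v ! i < q"
    using assms(1,2) by (auto simp: hamming_vertices_def subset_iff)
  have "(\<Sum>b<q. of_bool (v[i := b] \<in> S) :: real) = 1" if "i < n" for i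
  proof -
    have "v[i := b] \<in> S \<longleftrightarrow> b = v ! i" for b
      using assms(2,3) hamming_dist_list_update[of i v b] that v(1) by (cases "b = v ! i") auto
    then show ?thesis
      using v(2)[OF that] by simp
  qed
  then show ?thesis by (simp add: line_sum_def)
qed

lemma line_sum_indicator_nonmember:
  assumes "finite S" "v \<notin> S" "length v = n"
  shows "line_sum q n (\<lambda>w. of_bool (w \<in> S)) v \<le> real (card {w \<in> S. hamming_dist v w \<le> 1})"
proof -
  define P where "P = {(i, b). i < n \<and> b < q \<and> v[i := b] \<in> S}"
  have P: "P = {p \<in> {..<n} \<times> {..<q}. v[fst p := snd p] \<in> S}"
    by (auto simp: P_def)
  have "line_sum q n (\<lambda>w. of_bool (w \<in> S)) v
      = (\<Sum>p\<in>{..<n} \<times> {..<q}. of_bool (v[fst p := snd p] \<in> S))"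
    unfolding line_sum_def by (simp only: sum.cartesian_product case_prod_unfold)
  also have "\<dots> = real (card P)"
    unfolding P by (simp add: of_bool_def sum.If_cases Int_def)
  also have "card P \<le> card {w \<in> S. hamming_dist v w \<le> 1}"
  proof (rule card_inj_on_le[where f = "\<lambda>(i, b). v[i := b]"])
    \<comment> \<open>Without a real change injectivity would fail: every pair
      \<open>(i, v ! i)\<close> gives back \<open>v\<close>, which is not in
      \<open>S\<close>.\<close>
    have changed: "b \<noteq> v ! i" if "(i, b) \<in> P" for i b
      using that assms(2) by (auto simp: P_def)
    show "(\<lambda>(i, b). v[i := b]) ` P \<subseteq> {w \<in> S. hamming_dist v w \<le> 1}"
    proof clarify
      fix i b assume ib: "(i, b) \<in> P"
      then show "v[i := b] \<in> S \<and> hamming_dist v (v[i := b]) \<le> 1"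
        using hamming_dist_list_update[of i v b] changed[OF ib] assms(3) by (simp add: P_def)
    qed
    show "inj_on (\<lambda>(i, b). v[i := b]) P"
    proof (rule inj_onI, clarify)
      fix i b j d
      assume ib: "(i, b) \<in> P" and jd: "(j, d) \<in> P" and eq: "v[i := b] = v[j := d]"
      have "i < length v" "j < length v"
        using ib jd assms(3) by (auto simp: P_def)
      then show "i = j \<and> b = d"
        using changed[OF ib] arg_cong[OF eq, of "\<lambda>u. u ! i"]
        by (auto simp: nth_list_update split: if_splits)
    qed
    show "finite {w \<in> S. hamming_dist v w \<le> 1}"
      using assms(1) by simp
  qed
  finally show ?thesis by simp
qed

lemma independent_packing_bound:
  fixes S :: "nat list set"
  assumes q: "q > 1" and n: "n > 0" and dvd: "q dvd n"
    and S: "S \<subseteq> hamming_vertices n q"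
    and indep: "\<And>v w. v \<in> S \<Longrightarrow> w \<in> S \<Longrightarrow> hamming_dist v w \<noteq> 1"
    and pack: "\<And>v. v \<in> hamming_vertices n q \<Longrightarrow> card {w \<in> S. hamming_dist v w \<le> 1} \<le> l"
  shows "real (card S) \<le> real l * real q ^ n / (real n * (real q - 1) + real q)"
proof (cases "card S = 0")
  case True
  then show ?thesis using q by simp
next
  case False
  let ?V = "hamming_vertices n q"
  define f :: "nat list \<Rightarrow> real" where "f w = of_bool (w \<in> S)" for w
  define k where "k = real n * (real q - 1)"
  \<comment> \<open>With \<open>c = m\<close> the two factors of the form become
    \<open>L - n = A\<close> and \<open>L - n + q = A + q\<close>.\<close>
  obtain m where m: "n = q * m" using dvd by blast
  have "finite S" using S by (rule finite_subset) simp
  have kpos: "k > 0" using q n by (simp add: k_def)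
  have total: "(\<Sum>v\<in>?V. f v) = real (card S)"
    using S by (simp add: f_def of_bool_def sum.If_cases Int_absorb1)
  have "(real q)\<^sup>2 * ((real n - real m) * (real n - real m + 1)) = k * (k + real q)"
    by (simp add: k_def m power2_eq_square algebra_simps)
  then have "k * (k + real q) * (real (card S))\<^sup>2 / real q ^ n
      \<le> (\<Sum>v\<in>?V. spectral_form (real q) (real m) (f v) (line_sum q n f v))"
    using spectral_inequality[of q n "int m" f] q by (simp add: total)
  \<comment> \<open>The new summand is \<open>l\<close> times \<open>A f\<close>. On
    \<open>S\<close> both sides are 0; elsewhere \<open>f\<close> is 0 and the form is the square of
    \<open>A f\<close>, which lies between 0 and \<open>l\<close>.\<close>
  also have "\<dots> \<le> (\<Sum>v\<in>?V. real l * (line_sum q n f v - real n * f v))"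
  proof (rule sum_mono)
    fix v assume v: "v \<in> ?V"
    show "spectral_form (real q) (real m) (f v) (line_sum q n f v)
        \<le> real l * (line_sum q n f v - real n * f v)"
    proof (cases "v \<in> S")
      case True
      then have "line_sum q n f v = real n"
        unfolding f_def using S indep by (intro line_sum_indicator_member) auto
      then show ?thesis
        using True by (simp add: spectral_form_def f_def m power2_eq_square algebra_simps)
    next
      case False
      have "line_sum q n f v \<le> real (card {w \<in> S. hamming_dist v w \<le> 1})"
        unfolding f_def using False v \<open>finite S\<close>
        by (intro line_sum_indicator_nonmember) (auto simp: hamming_vertices_def)
      also have "\<dots> \<le> real l" using pack[OF v] by simp
      finally have "line_sum q n f v \<le> real l" .
      moreover have "0 \<le> line_sum q n f v"
        by (simp add: line_sum_def f_def sum_nonneg)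
      ultimately show ?thesis
        using False by (simp add: spectral_form_def f_def power2_eq_square mult_right_mono)
    qed
  qed
  also have "\<dots> = real l * k * real (card S)"
    by (simp add: sum_subtractf sum_line_sum total k_def algebra_simps flip: sum_distrib_left)
  finally have "(k * real (card S)) * ((k + real q) * real (card S))
      \<le> (k * real (card S)) * (real l * real q ^ n)"
    using q by (simp add: field_simps power2_eq_square)
  \<comment> \<open>The cancelled factor is positive because the empty code was split off.\<close>
  then have "(k + real q) * real (card S) \<le> real l * real q ^ n"
    using kpos False by (subst (asm) mult_le_cancel_left_pos) auto
  then show ?thesis
    using kpos q by (simp add: k_def pos_le_divide_eq mult.commute)
qed

section \<open>From multisets of minimum distance 2 to independent sets\<close>

lemma hamming_dist_self [simp]: "hamming_dist x x = 0"
  by (simp add: hamming_dist_def)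

lemma has_min_distance_count_le:
  assumes "has_min_distance C d" "d > 0"
  shows "count C x \<le> 1"
proof (rule ccontr)
  assume "\<not> count C x \<le> 1"
  then have "{#x, x#} \<subseteq># C" by (simp add: subseteq_mset_def)
  then have "d \<le> hamming_dist x x" using assms(1) unfolding has_min_distance_def by blast
  then show False using assms(2) by simp
qed

lemma has_min_distance_le:
  assumes "has_min_distance C d" "x \<in># C" "y \<in># C" "x \<noteq> y"
  shows "d \<le> hamming_dist x y"
proof -
  have "{#x, y#} \<subseteq># C"
    using assms(2-4) by (auto simp: subseteq_mset_def Suc_le_eq)
  then show ?thesis using assms(1) unfolding has_min_distance_def by blast
qed

theorem theorem2:
  fixes q n l :: nat and C :: "nat list multiset"
  assumes "q > 2" and "n \<ge> 1" and "[n = q] (mod q\<^sup>2)" and "l > 0"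
    and "one_packing n q l C" and "has_min_distance C 2"
  shows "real (size C) \<le> real l * real q ^ n / (real n * (real q - 1) + real q)"
proof -
  have "count C x \<le> 1" for x
    using has_min_distance_count_le[OF assms(6)] by simp
  then have "count C x = 1" if "x \<in># C" for x
    using that by (simp add: le_antisym Suc_le_eq)
  then have size: "size C = card (set_mset C)"
    by (simp add: size_multiset_overloaded_eq)
  have "[n = q] (mod q)"
    using assms(3) by (simp add: cong_dvd_modulus_nat power2_eq_square)
  then have dvd: "q dvd n"
    by (simp add: cong_def dvd_eq_mod_eq_0)
  have pack: "card {w \<in> set_mset C. hamming_dist v w \<le> 1} \<le> l"
    if "v \<in> hamming_vertices n q" for v
  proof -
    have "card {w \<in> set_mset C. hamming_dist v w \<le> 1}
        \<le> size {#c \<in># C. hamming_dist v c \<le> 1#}"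
      \<comment> \<open>The size is a sum of multiplicities, each at least 1 on the support.\<close>
      using sum_mono[of "set_mset {#c \<in># C. hamming_dist v c \<le> 1#}" "\<lambda>_. 1" "count {#c \<in># C. hamming_dist v c \<le> 1#}"]
      by (simp add: size_multiset_overloaded_eq Suc_le_eq)
    also have "\<dots> \<le> l" using assms(5) that by (simp add: one_packing_def)
    finally show ?thesis .
  qed
  \<comment> \<open>Equal words are at distance 0, distinct ones at distance at least 2.\<close>
  have "hamming_dist v w \<noteq> 1" if "v \<in># C" "w \<in># C" for v w
    using has_min_distance_le[OF assms(6) that] by (cases "v = w") auto
  then show ?thesis
    unfolding size using assms(1,2,5) dvd pack
    by (intro independent_packing_bound) (auto simp: one_packing_def)
qed

end
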